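(* Let $\lambda,\kappa\in\mathbf{k}$ and let $(\mathfrak{g},[\,,\,],P)$ be an extended Rota-Baxter Lie algebra of weight $(\lambda,\kappa)$. Then the binary operation $$x\circ y:=[P(x),y],\quad x,y\in\mathfrak{g},$$ makes $(\mathfrak{g},[\,,\,],\circ)$ into an extended post-Lie algebra of weight $(\lambda,\kappa)$.
   Context: $\mathbf{k}$ is a field of characteristic $0$; all operations are bilinear. An extended Rota-Baxter Lie algebra of weight $(\lambda,\kappa)$ is a vector space $\mathfrak{g}$ with a Lie bracket $[\,,\,]$ and a linear operator $P:\mathfrak{g}\to\mathfrak{g}$ such that $[P(x),P(y)]=P([P(x),y]+[x,P(y)]+\lambda[x,y])+\kappa[x,y]$ for all $x,y\in\mathfrak{g}$. An extended post-Lie algebra of weight $(\lambda,\kappa)$ is a vector space $A$ with binary operations $\circ$ and $[\,,\,]$, where $[\,,\,]$ is a Lie bracket, such that for all $x,y,z\in A$: $(x\circ y)\circ z-(y\circ x)\circ z+\lambda[x,y]\circ z+\kappa[[x,y],z]=x\circ(y\circ z)-y\circ(x\circ z)$ and $x\circ[y,z]=[x\circ y,z]+[y,x\circ z]$. *)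

theory Defs
  imports Complex_Main
begin

text \<open>
  Vector spaces are those of the locale \<^locale>\<open>vector_space\<close>, with the carrier given by a type.
  The ground field is restricted to characteristic 0 by the class \<^class>\<open>field_char_0\<close>.
\<close>

definition bilinear_op ::
  "('k::field \<Rightarrow> 'g::ab_group_add \<Rightarrow> 'g) \<Rightarrow> ('g \<Rightarrow> 'g \<Rightarrow> 'g) \<Rightarrow> bool" where
  "bilinear_op scale f \<longleftrightarrow>
     (\<forall>x. Vector_Spaces.linear scale scale (f x)) \<and>
     (\<forall>y. Vector_Spaces.linear scale scale (\<lambda>x. f x y))"

locale lie_algebra = vector_space scale
  for scale :: "'k::field_char_0 \<Rightarrow> 'g::ab_group_add \<Rightarrow> 'g" +
  fixes bracket :: "'g \<Rightarrow> 'g \<Rightarrow> 'g"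
  assumes bracket_bilinear: "bilinear_op scale bracket"
    and bracket_self: "bracket x x = 0"
    and jacobi:
      "bracket x (bracket y z) + bracket y (bracket z x) + bracket z (bracket x y) = 0"

locale extended_rota_baxter_lie_algebra = lie_algebra scale bracket
  for scale :: "'k::field_char_0 \<Rightarrow> 'g::ab_group_add \<Rightarrow> 'g"
    and bracket :: "'g \<Rightarrow> 'g \<Rightarrow> 'g" +
  fixes lam kap :: 'k
    and P :: "'g \<Rightarrow> 'g"
  assumes P_linear: "Vector_Spaces.linear scale scale P"
    and rota_baxter:
      "bracket (P x) (P y) =
         P (bracket (P x) y + bracket x (P y) + scale lam (bracket x y))
           + scale kap (bracket x y)"

locale extended_post_lie_algebra = lie_algebra scale bracket
  for scale :: "'k::field_char_0 \<Rightarrow> 'g::ab_group_add \<Rightarrow> 'g"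
    and bracket :: "'g \<Rightarrow> 'g \<Rightarrow> 'g" +
  fixes lam kap :: 'k
    and circ :: "'g \<Rightarrow> 'g \<Rightarrow> 'g"
  assumes circ_bilinear: "bilinear_op scale circ"
    and post_lie:
      "circ (circ x y) z - circ (circ y x) z
         + scale lam (circ (bracket x y) z) + scale kap (bracket (bracket x y) z) =
       circ x (circ y z) - circ y (circ x z)"
    and circ_derivation:
      "circ x (bracket y z) = bracket (circ x y) z + bracket y (circ x z)"

end

theory Submission
  imports Defs
begin

text \<open>
  By the Jacobi identity, every \<open>ad u = [u, -]\<close> is a derivation of the bracket and
  \<open>u \<mapsto> ad u\<close> is a representation: \<open>ad [u, v] = ad u ad v - ad v ad u\<close>. Since left
  multiplication by \<open>x\<close> for the new product is \<open>ad (P x)\<close>, it is a derivation, which is the second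
  post-Lie axiom. For the first one, the right-hand side
  \<open>ad (P x) ad (P y) z - ad (P y) ad (P x) z\<close> is \<open>[[P x, P y], z]\<close> because \<open>ad\<close> is a
  representation. Expanding \<open>[P x, P y]\<close> by the Rota-Baxter identity
  and using linearity of \<open>P\<close> gives exactly the four terms of the left-hand side, the sign of the
  second one coming from \<open>[x, P y] = - [P y, x]\<close>.
\<close>

context lie_algebra
begin

lemma linear_bracket_right: "Vector_Spaces.linear scale scale (bracket x)"
  using bracket_bilinear by (simp add: bilinear_op_def)

lemma linear_bracket_left: "Vector_Spaces.linear scale scale (\<lambda>x. bracket x y)"
  using bracket_bilinear by (simp add: bilinear_op_def)

lemmas bracket_add_right = module_hom.add[OF module_hom_linearI[OF linear_bracket_right]]
  and bracket_minus_right = module_hom.neg[OF module_hom_linearI[OF linear_bracket_right]]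
  and bracket_add_left = module_hom.add[OF module_hom_linearI[OF linear_bracket_left]]
  and bracket_diff_left = module_hom.diff[OF module_hom_linearI[OF linear_bracket_left]]
  and bracket_scale_left = module_hom.scale[OF module_hom_linearI[OF linear_bracket_left]]

text \<open>Polarization of \<open>[x + y, x + y] = 0\<close>.\<close>
lemma bracket_skew: "bracket y x = - bracket x y"
proof -
  have "bracket (x + y) (x + y) = bracket x y + bracket y x"
    unfolding bracket_add_left bracket_add_right by (simp add: bracket_self)
  then show ?thesis
    by (simp only: bracket_self eq_neg_iff_add_eq_0 add.commute)
qed

text \<open>
  The cyclic Jacobi identity in derivation form: skew-symmetry turns \<open>[y, [z, x]]\<close> into
  \<open>- [y, [x, z]]\<close> and \<open>[z, [x, y]]\<close> into \<open>- [[x, y], z]\<close>.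
\<close>
lemma bracket_derivation:
  "bracket x (bracket y z) = bracket (bracket x y) z + bracket y (bracket x z)"
proof -
  have "bracket y (bracket z x) = - bracket y (bracket x z)"
    by (simp add: bracket_skew[of z x] bracket_minus_right)
  moreover have "bracket z (bracket x y) = - bracket (bracket x y) z"
    by (rule bracket_skew)
  ultimately show ?thesis
    using jacobi[of x y z] by (simp add: algebra_simps)
qed

end

context extended_rota_baxter_lie_algebra
begin

lemmas P_add = module_hom.add[OF module_hom_linearI[OF P_linear]]
  and P_diff = module_hom.diff[OF module_hom_linearI[OF P_linear]]
  and P_scale = module_hom.scale[OF module_hom_linearI[OF P_linear]]

lemma bilinear_op_bracket_P: "bilinear_op scale (\<lambda>x y. bracket (P x) y)"
  unfolding bilinear_op_def
  using linear_bracket_right Vector_Spaces.linear_compose[OF P_linear linear_bracket_left]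
  by (simp add: o_def)

text \<open>
  The Rota-Baxter identity rearranged so that every argument of \<open>P\<close> is a value of the new product
  or of the bracket; applying \<open>[-, z]\<close> to it gives the left-hand side of the first post-Lie axiom.
\<close>
lemma bracket_P_P:
  "bracket (P x) (P y) =
     P (bracket (P x) y) - P (bracket (P y) x) + scale lam (P (bracket x y))
       + scale kap (bracket x y)"
  by (simp add: rota_baxter bracket_skew[of x "P y"] P_add P_diff P_scale)

end

theorem theorem2p19:
  fixes scale :: "'k::field_char_0 \<Rightarrow> 'g::ab_group_add \<Rightarrow> 'g"
    and bracket :: "'g \<Rightarrow> 'g \<Rightarrow> 'g"
    and lam kap :: 'k
    and P :: "'g \<Rightarrow> 'g"
  assumes "extended_rota_baxter_lie_algebra scale bracket lam kap P"
  shows "extended_post_lie_algebra scale bracket lam kap (\<lambda>x y. bracket (P x) y)"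
proof -
  interpret extended_rota_baxter_lie_algebra scale bracket lam kap P
    by (rule assms)
  show ?thesis
  proof
    show "bilinear_op scale (\<lambda>x y. bracket (P x) y)"
      by (rule bilinear_op_bracket_P)
  next
    fix x y z
    have "bracket (P (bracket (P x) y)) z - bracket (P (bracket (P y) x)) z
        + scale lam (bracket (P (bracket x y)) z) + scale kap (bracket (bracket x y) z)
      = bracket (bracket (P x) (P y)) z"
      unfolding bracket_P_P
      by (simp only: bracket_add_left bracket_diff_left bracket_scale_left)
    also have "\<dots> = bracket (P x) (bracket (P y) z) - bracket (P y) (bracket (P x) z)"
      by (simp add: bracket_derivation[of "P x" "P y" z])
    finally show "bracket (P (bracket (P x) y)) z - bracket (P (bracket (P y) x)) z
        + scale lam (bracket (P (bracket x y)) z) + scale kap (bracket (bracket x y) z)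
      = bracket (P x) (bracket (P y) z) - bracket (P y) (bracket (P x) z)" .
  next
    fix x y z
    show "bracket (P x) (bracket y z) = bracket (bracket (P x) y) z + bracket y (bracket (P x) z)"
      by (rule bracket_derivation)
  qed
qed

end
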